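(* Fix a nonnegative integer $k$, and for positive integers $m$ let $e_k(m)$ be the number of partial orders on $\{1,\dots,m+k\}$ whose set of minimal elements is exactly $\{1,\dots,m\}$. Put $z_2=2$, $z_3=6$, $z_4=20$ and $z_i=2i$ for $i\ge5$. Then, as $m\to\infty$, $$e_k(m)=2^{km}+\sum_{i=2}^{k} z_i\binom{k}{i}\bigl(2^{k-1}+2^{k-i}\bigr)^m+O\bigl(2^{(k-1)m}\bigr)=2^{km}\bigl(1+O((\tfrac34)^m)\bigr).$$ In particular $e_k(m)$ is asymptotically equal to $2^{km}$. *)

theory Defs
  imports Complex_Main "HOL-Library.Landau_Symbols"
begin

definition minimal_elements :: "'a set \<Rightarrow> 'a rel \<Rightarrow> 'a set" where
  "minimal_elements A r = {x \<in> A. \<forall>y \<in> A. (y, x) \<in> r \<longrightarrow> y = x}"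

definition num_orders :: "nat \<Rightarrow> nat \<Rightarrow> nat" where
  "num_orders k m =
     card {r :: nat rel. partial_order_on {1..m + k} r \<and>
                         minimal_elements {1..m + k} r = {1..m}}"

text \<open>Only the values at \<open>i \<ge> 2\<close> are meaningful.\<close>
definition z_coeff :: "nat \<Rightarrow> nat" where
  "z_coeff i = (if i = 2 then 2 else if i = 3 then 6 else if i = 4 then 20 else 2 * i)"

end

theory Submission
  imports Defs "HOL-Library.FuncSet"
begin

text \<open>
  An order with minimal elements \<open>M\<close> and remaining elements \<open>K\<close> amounts to an order \<open>q\<close> on \<open>K\<close> together with
  an \<open>m\<close>-tuple of up-sets of \<open>q\<close> covering \<open>K\<close>. The tuples that do not cover miss a point of \<open>K\<close>, so there
  are \<open>O(2 ^ ((k - 1) * m))\<close> of them, and the count is the sum over \<open>q\<close> of \<open>u(q) ^ m\<close> up to that error, where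
  \<open>u(q)\<close> is the number of up-sets. Only orders with \<open>u(q) > 2 ^ (k - 1)\<close> matter: the antichain, the
  stars on \<open>i\<close> points with \<open>u = 2 ^ (k - 1) + 2 ^ (k - i)\<close>, and two disjoint edges, which have as many
  up-sets as a star on four points. The latter raise \<open>z\<^sub>4\<close> from \<open>8\<close> to \<open>20\<close>, while for \<open>i = 2\<close> the upward and
  the downward stars coincide.
\<close>

section \<open>Closed subsets of a relation and product bounds over blocks\<close>

text \<open>For a partial order on \<open>X\<close> these are its up-sets. \<open>E\<close> may be
  any relation, possibly on a larger set: pairs leaving \<open>X\<close> impose nothing, so the same
  \<open>E\<close> serves for every block of points.\<close>

definition closed_subsets :: "'a set \<Rightarrow> 'a rel \<Rightarrow> 'a set set" where
  "closed_subsets X E = {A. A \<subseteq> X \<and> (\<forall>x y. (x, y) \<in> E \<longrightarrow> y \<in> X \<longrightarrow> x \<in> A \<longrightarrow> y \<in> A)}"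

lemma closed_subsets_subset_Pow: "closed_subsets X E \<subseteq> Pow X"
  by (auto simp: closed_subsets_def)

lemma finite_closed_subsets: "finite X \<Longrightarrow> finite (closed_subsets X E)"
  by (rule finite_subset[OF closed_subsets_subset_Pow]) simp

lemma card_closed_subsets_le: "finite X \<Longrightarrow> card (closed_subsets X E) \<le> 2 ^ card X"
  using card_mono[OF _ closed_subsets_subset_Pow, of X E] by (simp add: card_Pow)

lemma closed_subsets_minus_Id: "closed_subsets X (E - Id) = closed_subsets X E"
  by (auto simp: closed_subsets_def)

lemma closed_subsets_Un_subset:
  "(\<lambda>A. (A \<inter> X, A \<inter> Y)) ` closed_subsets (X \<union> Y) E \<subseteq> closed_subsets X E \<times> closed_subsets Y E"
  unfolding closed_subsets_def by blast

lemma inj_on_Int_pair: "inj_on (\<lambda>A. (A \<inter> X, A \<inter> Y)) (closed_subsets (X \<union> Y) E)"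
  unfolding closed_subsets_def by (rule inj_onI) blast

text \<open>A closed set is determined by its traces on the two blocks, and each trace is closed
  there. Pairs between the blocks can only lower the count.\<close>

lemma card_closed_subsets_Un_le:
  assumes "finite X" "finite Y"
  shows "card (closed_subsets (X \<union> Y) E) \<le> card (closed_subsets X E) * card (closed_subsets Y E)"
proof -
  have "card (closed_subsets (X \<union> Y) E) \<le> card (closed_subsets X E \<times> closed_subsets Y E)"
    by (rule card_inj_on_le[OF inj_on_Int_pair closed_subsets_Un_subset])
       (simp add: assms finite_closed_subsets)
  then show ?thesis by (simp add: card_cartesian_product)
qed

text \<open>Without pairs between disjoint blocks, any two closed sets have a closed union, so the
  trace map is onto the product.\<close>

lemma card_closed_subsets_Un:
  assumes "X \<inter> Y = {}" and "E \<inter> (X \<times> Y) = {}" and "E \<inter> (Y \<times> X) = {}"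
  shows "card (closed_subsets (X \<union> Y) E) = card (closed_subsets X E) * card (closed_subsets Y E)"
proof -
  have "closed_subsets X E \<times> closed_subsets Y E
      \<subseteq> (\<lambda>A. (A \<inter> X, A \<inter> Y)) ` closed_subsets (X \<union> Y) E"
  proof (clarify)
    fix A B assume AB: "A \<in> closed_subsets X E" "B \<in> closed_subsets Y E"
    have "(A, B) = (\<lambda>A. (A \<inter> X, A \<inter> Y)) (A \<union> B)" "A \<union> B \<in> closed_subsets (X \<union> Y) E"
      using AB assms unfolding closed_subsets_def by blast+
    then show "(A, B) \<in> (\<lambda>A. (A \<inter> X, A \<inter> Y)) ` closed_subsets (X \<union> Y) E" by blast
  qed
  then have "(\<lambda>A. (A \<inter> X, A \<inter> Y)) ` closed_subsets (X \<union> Y) E = closed_subsets X E \<times> closed_subsets Y E"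
    using closed_subsets_Un_subset by (intro equalityI)
  then show ?thesis
    using card_image[OF inj_on_Int_pair, of X Y E] by (simp add: card_cartesian_product)
qed

text \<open>The fraction of subsets that are closed is at most the product of the fractions on
  \<open>T\<close> and on \<open>K - T\<close>, and the latter is at most 1. A single bad block
  therefore bounds the whole of \<open>K\<close>.\<close>

lemma closed_subsets_half_extend:
  assumes "finite K" "T \<subseteq> K" "2 * card (closed_subsets T E) \<le> 2 ^ card T"
  shows "2 * card (closed_subsets K E) \<le> 2 ^ card K"
proof -
  have fin: "finite T" "finite (K - T)" using assms finite_subset by auto
  have K: "T \<union> (K - T) = K" using assms by blast
  have "2 * card (closed_subsets K E) \<le> (2 * card (closed_subsets T E)) * card (closed_subsets (K - T) E)"
    using card_closed_subsets_Un_le[OF fin, of E] unfolding K by simp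
  also have "\<dots> \<le> 2 ^ card T * 2 ^ card (K - T)"
    using assms(3) card_closed_subsets_le[OF fin(2), of E] by (rule mult_le_mono)
  also have "\<dots> = 2 ^ card K"
    using card_Un_disjoint[OF fin] K by (simp add: power_add[symmetric])
  finally show ?thesis .
qed

section \<open>Closed subsets of small configurations\<close>

text \<open>Bounding by the length of an explicit list spares any proof that the listed sets differ,
  so the points of a configuration may coincide.\<close>

lemma card_le_length: "S \<subseteq> set xs \<Longrightarrow> card S \<le> length xs"
  by (meson List.finite_set card_length card_mono le_trans)

lemma closed_subsets_edge:
  assumes "(a, b) \<in> E"
  shows "closed_subsets {a, b} E \<subseteq> set [{}, {b}, {a, b}]"
proof
  fix A assume "A \<in> closed_subsets {a, b} E"
  then have "A \<in> Pow {a, b}" "a \<in> A \<longrightarrow> b \<in> A" using assms by (auto simp: closed_subsets_def)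
  then show "A \<in> set [{}, {b}, {a, b}]" by (auto simp: Pow_insert)
qed

lemma closed_subsets_chain:
  assumes "(a, b) \<in> E" "(b, c) \<in> E"
  shows "closed_subsets {a, b, c} E \<subseteq> set [{}, {c}, {b, c}, {a, b, c}]"
proof
  fix A assume "A \<in> closed_subsets {a, b, c} E"
  then have "A \<in> Pow {a, b, c}" "a \<in> A \<longrightarrow> b \<in> A" "b \<in> A \<longrightarrow> c \<in> A"
    using assms by (auto simp: closed_subsets_def)
  then show "A \<in> set [{}, {c}, {b, c}, {a, b, c}]" by (auto simp: Pow_insert)
qed

lemma closed_subsets_fork:
  assumes "(a, b) \<in> E" "(a, c) \<in> E"
  shows "closed_subsets {a, b, c} E \<subseteq> set [{}, {b}, {c}, {b, c}, {a, b, c}]"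
proof
  fix A assume "A \<in> closed_subsets {a, b, c} E"
  then have "A \<in> Pow {a, b, c}" "a \<in> A \<longrightarrow> b \<in> A" "a \<in> A \<longrightarrow> c \<in> A"
    using assms by (auto simp: closed_subsets_def)
  then show "A \<in> set [{}, {b}, {c}, {b, c}, {a, b, c}]" by (auto simp: Pow_insert)
qed

lemma closed_subsets_join:
  assumes "(a, c) \<in> E" "(b, c) \<in> E"
  shows "closed_subsets {a, b, c} E \<subseteq> set [{}, {c}, {a, c}, {b, c}, {a, b, c}]"
proof
  fix A assume "A \<in> closed_subsets {a, b, c} E"
  then have "A \<in> Pow {a, b, c}" "a \<in> A \<longrightarrow> c \<in> A" "b \<in> A \<longrightarrow> c \<in> A"
    using assms by (auto simp: closed_subsets_def)
  then show "A \<in> set [{}, {c}, {a, c}, {b, c}, {a, b, c}]" by (auto simp: Pow_insert)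
qed

text \<open>A closed set containing \<open>a\<close> contains \<open>b\<close> and \<open>d\<close>,
  which leaves 2 choices. One avoiding \<open>a\<close> is closed in the point \<open>b\<close> next
  to the edge from \<open>c\<close> to \<open>d\<close>, which leaves at most 2 * 3.\<close>

lemma card_closed_subsets_zigzag:
  assumes "(a, b) \<in> E" "(a, d) \<in> E" "(c, d) \<in> E"
  shows "card (closed_subsets {a, b, c, d} E) \<le> 8"
proof -
  have "closed_subsets {a, b, c, d} E
      \<subseteq> set [{a, b, d}, {a, b, c, d}] \<union> closed_subsets ({b} \<union> {c, d}) E"
  proof
    fix A assume A: "A \<in> closed_subsets {a, b, c, d} E"
    show "A \<in> set [{a, b, d}, {a, b, c, d}] \<union> closed_subsets ({b} \<union> {c, d}) E"
    proof (cases "a \<in> A")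
      case True
      then have "b \<in> A" "d \<in> A" "A \<subseteq> {a, b, c, d}"
        using A assms unfolding closed_subsets_def by blast+
      with True have "A = {a, b, d} \<or> A = {a, b, c, d}" by blast
      then show ?thesis by auto
    next
      case False
      then have "A \<in> closed_subsets ({b} \<union> {c, d}) E"
        using A unfolding closed_subsets_def by blast
      then show ?thesis by blast
    qed
  qed
  then have "card (closed_subsets {a, b, c, d} E)
      \<le> card (set [{a, b, d}, {a, b, c, d}] \<union> closed_subsets ({b} \<union> {c, d}) E)"
    by (rule card_mono[rotated]) (simp add: finite_closed_subsets)
  also have "\<dots> \<le> card (set [{a, b, d}, {a, b, c, d}]) + card (closed_subsets ({b} \<union> {c, d}) E)"
    by (rule card_Un_le)
  also have "card (set [{a, b, d}, {a, b, c, d}]) \<le> 2"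
    using card_length[of "[{a, b, d}, {a, b, c, d}]"] by simp
  also have "card (closed_subsets ({b} \<union> {c, d}) E)
      \<le> card (closed_subsets {b} E) * card (closed_subsets {c, d} E)"
    by (rule card_closed_subsets_Un_le) auto
  also have "\<dots> \<le> 2 * 3"
    using card_closed_subsets_le[of "{b}" E] card_le_length[OF closed_subsets_edge[OF assms(3)]]
    by (intro mult_le_mono) auto
  finally show ?thesis by simp
qed

section \<open>Classification of the orders with many up-sets\<close>

text \<open>
  The strict parts of the non-discrete orders with more than \<open>2 ^ (k - 1)\<close> up-sets. A star with a single
  leaf is both an up-star and a down-star; it is counted among the former only.
\<close>

definition up_stars :: "'a set \<Rightarrow> 'a rel set" where
  "up_stars K = (\<lambda>(c, L). {c} \<times> L) ` (SIGMA c:K. {L. L \<subseteq> K - {c} \<and> 1 \<le> card L})"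

definition down_stars :: "'a set \<Rightarrow> 'a rel set" where
  "down_stars K = (\<lambda>(c, L). L \<times> {c}) ` (SIGMA c:K. {L. L \<subseteq> K - {c} \<and> 2 \<le> card L})"

definition double_edges :: "'a set \<Rightarrow> 'a rel set" where
  "double_edges K = {{(a, b), (c, d)} | a b c d. distinct [a, b, c, d] \<and> {a, b, c, d} \<subseteq> K}"

text \<open>
  The fraction of the subsets of a block that are closed is at most \<open>1 / 2\<close> for a chain \<open>a < b < c\<close> and for
  a zigzag \<open>b > a < d > c\<close>, at most \<open>15 / 32\<close> for a fork or a join next to a disjoint edge, and at most
  \<open>27 / 64\<close> for three disjoint edges. A relation avoiding all of these is a star or a pair of
  disjoint edges.
\<close>

lemma many_closed_subsets_cases:
  assumes fin: "finite K" and po: "partial_order_on K q"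
    and big: "2 ^ card K < 2 * card (closed_subsets K q)"
  shows "q - Id \<in> {{}} \<union> up_stars K \<union> down_stars K \<union> double_edges K"
proof -
  define E where "E = q - Id"
  have EK: "E \<subseteq> K \<times> K" and irr: "\<And>x. (x, x) \<notin> E" and anti: "\<And>x y. (x, y) \<in> E \<Longrightarrow> (y, x) \<notin> E"
    using po by (auto simp: E_def partial_order_on_def preorder_on_def antisym_def)
  \<comment> \<open>Loops do not affect closedness, so the hypothesis on \<open>q\<close> passes to
    its strict part \<open>E\<close>: no block can have at most half of its subsets closed.\<close>
  have H: False if "T \<subseteq> K" "2 * card (closed_subsets T E) \<le> 2 ^ card T" for T
    using closed_subsets_half_extend[OF fin that] big by (simp add: E_def closed_subsets_minus_Id)
  \<comment> \<open>For disjoint blocks the fractions multiply; this combines a fork, a join or two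
    edges with one further edge.\<close>
  have H2: False if "T \<subseteq> K" "S \<subseteq> K" "T \<inter> S = {}" "card (closed_subsets T E) \<le> t"
    "card (closed_subsets S E) \<le> s" "2 * (t * s) \<le> 2 ^ card T * 2 ^ card S" for T S t s
  proof (rule H[of "T \<union> S"])
    have f: "finite T" "finite S" using that(1,2) finite_subset[OF _ fin] by blast+
    show "2 * card (closed_subsets (T \<union> S) E) \<le> 2 ^ card (T \<union> S)"
      using card_closed_subsets_Un_le[OF f, of E] mult_le_mono[OF that(4,5)] that(6) f that(3)
      by (simp add: card_Un_disjoint power_add)
  qed (use that in auto)
  have chain: False if "(a, b) \<in> E" "(b, c) \<in> E" for a b c
  proof (rule H[of "{a, b, c}"])
    have "a \<noteq> b" "b \<noteq> c" "a \<noteq> c" using that irr anti by auto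
    then show "2 * card (closed_subsets {a, b, c} E) \<le> 2 ^ card {a, b, c}"
      using card_le_length[OF closed_subsets_chain[OF that]] by simp
  qed (use that EK in auto)
  have zigzag: False if "(a, b) \<in> E" "(a, d) \<in> E" "(c, d) \<in> E" "a \<noteq> c" "b \<noteq> d" for a b c d
  proof (rule H[of "{a, b, c, d}"])
    \<comment> \<open>Without chains no source is a target, so the four points are distinct and at
      most 8 of 16 subsets are closed.\<close>
    have "a \<noteq> b" "a \<noteq> d" "b \<noteq> c" "c \<noteq> d" using that irr chain by blast+
    then show "2 * card (closed_subsets {a, b, c, d} E) \<le> 2 ^ card {a, b, c, d}"
      using that(4,5) card_closed_subsets_zigzag[OF that(1-3)] by simp
  qed (use that EK in auto)
  have edge: "card (closed_subsets {a, b} E) \<le> 3" if "(a, b) \<in> E" for a b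
    using card_le_length[OF closed_subsets_edge[OF that]] by simp
  have fork: False if "(a, b) \<in> E" "(a, c) \<in> E" "(x, y) \<in> E" "b \<noteq> c" "{a, b, c} \<inter> {x, y} = {}" for a b c x y
  proof (rule H2[OF _ _ that(5) card_le_length[OF closed_subsets_fork[OF that(1,2)]] edge[OF that(3)]])
    show "2 * (length [{}, {b}, {c}, {b, c}, {a, b, c}] * 3) \<le> 2 ^ card {a, b, c} * (2::nat) ^ card {x, y}"
      using that irr by (cases "a = b"; cases "a = c"; cases "x = y") auto
  qed (use that EK in auto)
  have join: False if "(a, c) \<in> E" "(b, c) \<in> E" "(x, y) \<in> E" "a \<noteq> b" "{a, b, c} \<inter> {x, y} = {}" for a b c x y
  proof (rule H2[OF _ _ that(5) card_le_length[OF closed_subsets_join[OF that(1,2)]] edge[OF that(3)]])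
    show "2 * (length [{}, {c}, {a, c}, {b, c}, {a, b, c}] * 3) \<le> 2 ^ card {a, b, c} * (2::nat) ^ card {x, y}"
      using that irr by (cases "a = c"; cases "b = c"; cases "x = y") auto
  qed (use that EK in auto)
  have three: False if "(a, b) \<in> E" "(c, d) \<in> E" "(x, y) \<in> E" "{a, b} \<inter> {c, d} = {}"
    "{a, b, c, d} \<inter> {x, y} = {}" for a b c d x y
  proof (rule H2[of "{a, b} \<union> {c, d}" "{x, y}" 9 3])
    have "card (closed_subsets ({a, b} \<union> {c, d}) E)
        \<le> card (closed_subsets {a, b} E) * card (closed_subsets {c, d} E)"
      by (rule card_closed_subsets_Un_le) auto
    then show "card (closed_subsets ({a, b} \<union> {c, d}) E) \<le> 9"
      using mult_le_mono[OF edge[OF that(1)] edge[OF that(2)]] by linarith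
    have "a \<noteq> b" "c \<noteq> d" "x \<noteq> y" using that irr by auto
    then show "2 * (9 * 3) \<le> 2 ^ card ({a, b} \<union> {c, d}) * (2::nat) ^ card {x, y}"
      using that by (simp add: card_Un_disjoint)
  qed (use that EK edge in auto)
  \<comment> \<open>Two edges differing in both source and target are disjoint, as there are no
    chains, and then no third edge is possible. Otherwise any two edges share a source or a target,
    which forces a star.\<close>
  have "E = {} \<or> E \<in> up_stars K \<or> E \<in> down_stars K \<or> E \<in> double_edges K"
  proof (cases "\<exists>a b c d. (a, b) \<in> E \<and> (c, d) \<in> E \<and> a \<noteq> c \<and> b \<noteq> d")
    case True
    then obtain a b c d where e: "(a, b) \<in> E" "(c, d) \<in> E" "a \<noteq> c" "b \<noteq> d" by blast
    have d: "a \<noteq> b" "c \<noteq> d" "a \<noteq> d" "b \<noteq> c" using e irr chain by blast+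
    have "(x, y) = (a, b) \<or> (x, y) = (c, d)" if xy: "(x, y) \<in> E" for x y
    proof (rule ccontr)
      assume n: "\<not> ?thesis"
      have o: "x \<noteq> b" "x \<noteq> d" "y \<noteq> a" "y \<noteq> c" "x \<noteq> y" using chain e xy irr by blast+
      \<comment> \<open>With no chains, the third edge can meet the other two only source to source
        or target to target. Sharing one endpoint gives a fork or a join next to a disjoint edge;
        touching both edges gives a zigzag.\<close>
      consider "x = a" | "x = c" | "y = b" | "y = d" | "x \<notin> {a, b, c, d}" "y \<notin> {a, b, c, d}"
        using o by blast
      then show False
      proof cases
        case 1
        then show ?thesis
          using n o e d xy zigzag[of a b d c] fork[of a b y c d] by (cases "y = d") auto
      next
        case 2
        then show ?thesis
          using n o e d xy zigzag[of c d b a] fork[of c d y a b] by (cases "y = b") auto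
      next
        case 3
        then show ?thesis
          using n o e d xy zigzag[of c d b a] join[of a b x c d] by (cases "x = c") auto
      next
        case 4
        then show ?thesis
          using n o e d xy zigzag[of a b d c] join[of c d x a b] by (cases "x = a") auto
      next
        case 5
        then show ?thesis using three[OF e(1,2) xy] e d by auto
      qed
    qed
    then have "E = {(a, b), (c, d)}" using e by auto
    moreover have "distinct [a, b, c, d]" "{a, b, c, d} \<subseteq> K" using e d EK by auto
    ultimately show ?thesis unfolding double_edges_def by blast
  next
    case False
    then have pw: "x = x' \<or> y = y'" if "(x, y) \<in> E" "(x', y') \<in> E" for x y x' y' using that by blast
    show ?thesis
    proof (cases "E = {}")
      case False
      then obtain a b where ab: "(a, b) \<in> E" by auto
      show ?thesis
      proof (cases "\<exists>a'. a' \<noteq> a \<and> (a', b) \<in> E")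
        case True
        then obtain a' where a': "a' \<noteq> a" "(a', b) \<in> E" by blast
        define L where "L = {x. (x, b) \<in> E}"
        \<comment> \<open>An edge with a target other than \<open>b\<close> would have to share its
          source with both edges into \<open>b\<close>, whose sources differ.\<close>
        have "y = b" if "(x, y) \<in> E" for x y
          using pw[OF that ab] pw[OF that a'(2)] a'(1) by auto
        then have E: "E = L \<times> {b}" by (auto simp: L_def)
        have L: "L \<subseteq> K - {b}" using EK irr by (auto simp: L_def)
        have "{a, a'} \<subseteq> L" using ab a' by (auto simp: L_def)
        then have "card {a, a'} \<le> card L"
          using L fin by (intro card_mono) (auto intro: finite_subset)
        then have "2 \<le> card L" using a' by simp
        moreover have "b \<in> K" using ab EK by auto
        ultimately have "(b, L) \<in> (SIGMA c:K. {L. L \<subseteq> K - {c} \<and> 2 \<le> card L})" using L by blast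
        then show ?thesis unfolding down_stars_def using E by force
      next
        case False
        define L where "L = {y. (a, y) \<in> E}"
        \<comment> \<open>An edge either starts at \<open>a\<close> or ends in \<open>b\<close>, and
          here \<open>a\<close> is the only source below \<open>b\<close>. A single edge also ends
          up in this case, hence among the up-stars.\<close>
        have "x = a" if "(x, y) \<in> E" for x y
          using pw[OF that ab] False that by auto
        then have E: "E = {a} \<times> L" by (auto simp: L_def)
        have L: "L \<subseteq> K - {a}" using EK irr by (auto simp: L_def)
        have "b \<in> L" using ab by (auto simp: L_def)
        moreover have "finite L" using L fin by (auto intro: finite_subset)
        ultimately have "1 \<le> card L" by (auto simp: Suc_le_eq card_gt_0_iff)
        moreover have "a \<in> K" using ab EK by auto
        ultimately have "(a, L) \<in> (SIGMA c:K. {L. L \<subseteq> K - {c} \<and> 1 \<le> card L})" using L by blast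
        then show ?thesis unfolding up_stars_def using E by force
      qed
    qed auto
  qed
  then show ?thesis by (auto simp: E_def)
qed

section \<open>Up-set counts and power sums for stars and double edges\<close>

lemma sum_subsets_by_card:
  fixes f :: "nat \<Rightarrow> 'a::semiring_1"
  assumes "finite S"
  shows "(\<Sum>L | L \<subseteq> S \<and> j \<le> card L. f (card L)) = (\<Sum>l = j..card S. of_nat (card S choose l) * f l)"
proof -
  let ?A = "{L. L \<subseteq> S \<and> j \<le> card L}"
  have fin: "finite ?A" using assms by auto
  have im: "card ` ?A \<subseteq> {j..card S}" using assms by (auto intro: card_mono)
  have "(\<Sum>L\<in>?A. f (card L)) = (\<Sum>l = j..card S. \<Sum>L | L \<in> ?A \<and> card L = l. f (card L))"
    using sum.group[OF fin finite_atLeastAtMost im, of "\<lambda>L. f (card L)"] by (rule sym)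
  also have "\<dots> = (\<Sum>l = j..card S. of_nat (card S choose l) * f l)"
  proof (rule sum.cong[OF refl])
    fix l assume "l \<in> {j..card S}"
    then have "{L. L \<in> ?A \<and> card L = l} = {L. L \<subseteq> S \<and> card L = l}" by auto
    then show "(\<Sum>L | L \<in> ?A \<and> card L = l. f (card L)) = of_nat (card S choose l) * f l"
      using n_subsets[OF assms, of l] by simp
  qed
  finally show ?thesis .
qed

lemma card_closed_subsets_empty: "finite K \<Longrightarrow> card (closed_subsets K {}) = 2 ^ card K"
proof -
  assume "finite K"
  moreover have "closed_subsets K {} = Pow K" by (auto simp: closed_subsets_def)
  ultimately show ?thesis by (simp add: card_Pow)
qed

text \<open>Complementation in \<open>K\<close> exchanges up-sets and down-sets.\<close>

lemma card_closed_subsets_converse: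
  assumes "E \<subseteq> K \<times> K"
  shows "card (closed_subsets K (E\<inverse>)) = card (closed_subsets K E)"
proof (rule bij_betw_same_card)
  show "bij_betw (\<lambda>A. K - A) (closed_subsets K (E\<inverse>)) (closed_subsets K E)"
    by (rule bij_betw_byWitness[of _ "\<lambda>A. K - A"])
       (use assms in \<open>auto simp: closed_subsets_def\<close>)
qed

text \<open>Sets avoiding the centre \<open>c\<close> are unconstrained; sets containing it must
  contain \<open>L\<close> and are free elsewhere.\<close>

lemma card_closed_subsets_up_star:
  assumes "finite K" "c \<in> K" "L \<subseteq> K - {c}"
  shows "card (closed_subsets K ({c} \<times> L)) = 2 ^ (card K - 1) + 2 ^ (card K - Suc (card L))"
proof -
  let ?C = "insert c L"
  have finL: "finite L" using assms finite_subset by blast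
  have eq: "closed_subsets K ({c} \<times> L) = Pow (K - {c}) \<union> (\<union>) ?C ` Pow (K - ?C)"
  proof (intro equalityI subsetI)
    fix A assume A: "A \<in> closed_subsets K ({c} \<times> L)"
    show "A \<in> Pow (K - {c}) \<union> (\<union>) ?C ` Pow (K - ?C)"
    proof (cases "c \<in> A")
      case True
      then have "?C \<subseteq> A" "A \<subseteq> K" using A assms unfolding closed_subsets_def by blast+
      then have "A = ?C \<union> (A - ?C)" "A - ?C \<in> Pow (K - ?C)" by blast+
      then show ?thesis by blast
    qed (use A in \<open>auto simp: closed_subsets_def\<close>)
  next
    fix A assume "A \<in> Pow (K - {c}) \<union> (\<union>) ?C ` Pow (K - ?C)"
    then show "A \<in> closed_subsets K ({c} \<times> L)"
      using assms unfolding closed_subsets_def by auto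
  qed
  have inj: "inj_on ((\<union>) ?C) (Pow (K - ?C))" by (rule inj_onI) blast
  have "card (K - ?C) = card K - Suc (card L)"
    using assms finL by (subst card_Diff_subset) (auto simp: card_insert_if)
  then have "card ((\<union>) ?C ` Pow (K - ?C)) = 2 ^ (card K - Suc (card L))"
    unfolding card_image[OF inj] using assms by (simp add: card_Pow)
  moreover have "card (Pow (K - {c})) = 2 ^ (card K - 1)" using assms by (simp add: card_Pow)
  moreover have "card (closed_subsets K ({c} \<times> L)) = card (Pow (K - {c})) + card ((\<union>) ?C ` Pow (K - ?C))"
    unfolding eq using assms by (intro card_Un_disjoint) auto
  ultimately show ?thesis by simp
qed

lemma card_closed_subsets_down_star:
  assumes "finite K" "c \<in> K" "L \<subseteq> K - {c}"
  shows "card (closed_subsets K (L \<times> {c})) = 2 ^ (card K - 1) + 2 ^ (card K - Suc (card L))"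
  using card_closed_subsets_converse[of "{c} \<times> L" K] card_closed_subsets_up_star[OF assms] assms
  by (auto simp: converse_Times)

text \<open>Each edge admits 3 closed sets and the remaining points are free. The product 9 * 2^(k -
  4), with k = \<open>card K\<close>, is split as 8 + 1 to match the count for a star on four
  points.\<close>

lemma card_closed_subsets_double_edge:
  assumes "finite K" "distinct [a, b, c, d]" "{a, b, c, d} \<subseteq> K"
  shows "card (closed_subsets K {(a, b), (c, d)}) = 2 ^ (card K - 1) + 2 ^ (card K - 4)"
proof -
  let ?E = "{(a, b), (c, d)}" and ?R = "K - {a, b, c, d}"
  have K: "K = {a, b} \<union> ({c, d} \<union> ?R)" using assms by auto
  have "closed_subsets {a, b} ?E = {{}, {b}, {a, b}}"
    using closed_subsets_edge[of a b ?E] assms by (auto simp: closed_subsets_def)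
  then have ab: "card (closed_subsets {a, b} ?E) = 3" using assms by (auto simp: card_insert_if)
  have "closed_subsets {c, d} ?E = {{}, {d}, {c, d}}"
    using closed_subsets_edge[of c d ?E] assms by (auto simp: closed_subsets_def)
  then have cd: "card (closed_subsets {c, d} ?E) = 3" using assms by (auto simp: card_insert_if)
  have "closed_subsets ?R ?E = Pow ?R" by (auto simp: closed_subsets_def)
  moreover have c4: "card {a, b, c, d} = 4" using assms by simp
  then have "card ?R = card K - 4" using assms by (subst card_Diff_subset) auto
  ultimately have R: "card (closed_subsets ?R ?E) = 2 ^ (card K - 4)" using assms by (simp add: card_Pow)
  have "card (closed_subsets K ?E)
      = card (closed_subsets {a, b} ?E) * (card (closed_subsets {c, d} ?E) * card (closed_subsets ?R ?E))"
    by (subst K, subst card_closed_subsets_Un, (use assms in auto)[3],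
        subst card_closed_subsets_Un, (use assms in auto)[3]) simp
  also have "\<dots> = 8 * 2 ^ (card K - 4) + 2 ^ (card K - 4)" by (simp add: ab cd R)
  also have "4 \<le> card K" using card_mono[OF assms(1,3)] c4 by simp
  then have e: "card K - 1 = 3 + (card K - 4)" by arith
  have "8 * 2 ^ (card K - 4) = (2::nat) ^ (card K - 1)" unfolding e power_add by simp
  finally show ?thesis .
qed

lemma finite_star_families:
  assumes "finite K"
  shows "finite (up_stars K)" "finite (down_stars K)" "finite (double_edges K)"
proof -
  have "up_stars K \<subseteq> Pow (K \<times> K)" "down_stars K \<subseteq> Pow (K \<times> K)" "double_edges K \<subseteq> Pow (K \<times> K)"
    by (auto simp: up_stars_def down_stars_def double_edges_def)
  then show "finite (up_stars K)" "finite (down_stars K)" "finite (double_edges K)"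
    using assms by (auto intro: finite_subset)
qed

text \<open>The index i counts the points of the star, centre included. Choosing the centre first or
  last gives k * C(k - 1, l) = (l + 1) * C(k, l + 1), whence the factor i.\<close>

lemma star_sum:
  fixes f :: "nat \<Rightarrow> real"
  assumes "finite K"
  shows "(\<Sum>c\<in>K. \<Sum>L | L \<subseteq> K - {c} \<and> j \<le> card L. f (Suc (card L)))
    = (\<Sum>i = Suc j..card K. real i * real (card K choose i) * f i)"
proof (cases "card K")
  case 0
  then show ?thesis using assms by simp
next
  case (Suc n)
  have "(\<Sum>c\<in>K. \<Sum>L | L \<subseteq> K - {c} \<and> j \<le> card L. f (Suc (card L)))
      = (\<Sum>c\<in>K. \<Sum>l = j..n. real (n choose l) * f (Suc l))"
    using assms Suc by (intro sum.cong[OF refl] trans[OF sum_subsets_by_card]) auto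
  also have "\<dots> = (\<Sum>l = j..n. real (Suc n * (n choose l)) * f (Suc l))"
    using Suc by (simp add: sum_distrib_left algebra_simps)
  also have "\<dots> = (\<Sum>l = j..n. real (Suc l) * real (Suc n choose Suc l) * f (Suc l))"
    by (simp only: Suc_times_binomial_eq of_nat_mult mult_ac)
  also have "\<dots> = (\<Sum>i = Suc j..Suc n. real i * real (Suc n choose i) * f i)"
    by (simp only: sum.shift_bounds_cl_Suc_ivl)
  finally show ?thesis using Suc by simp
qed

lemma sum_up_stars:
  assumes "finite K"
  shows "(\<Sum>E\<in>up_stars K. real (card (closed_subsets K E)) ^ m)
    = (\<Sum>i = 2..card K. real i * real (card K choose i) * (2 ^ (card K - 1) + 2 ^ (card K - i)) ^ m)"
proof -
  let ?I = "SIGMA c:K. {L. L \<subseteq> K - {c} \<and> 1 \<le> card L}"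
  let ?g = "\<lambda>i. (2 ^ (card K - 1) + 2 ^ (card K - i) :: real) ^ m"
  \<comment> \<open>The leaf set is nonempty, so the product recovers both the centre and the
    leaves.\<close>
  have inj: "inj_on (\<lambda>(c, L). {c} \<times> L) ?I"
    by (rule inj_onI) (auto simp: times_eq_iff)
  have "(\<Sum>E\<in>up_stars K. real (card (closed_subsets K E)) ^ m)
      = (\<Sum>(c, L)\<in>?I. real (card (closed_subsets K ({c} \<times> L))) ^ m)"
    unfolding up_stars_def by (subst sum.reindex[OF inj]) (simp add: case_prod_unfold)
  also have "\<dots> = (\<Sum>(c, L)\<in>?I. ?g (Suc (card L)))"
    using assms by (intro sum.cong) (auto simp: card_closed_subsets_up_star)
  also have "\<dots> = (\<Sum>c\<in>K. \<Sum>L | L \<subseteq> K - {c} \<and> 1 \<le> card L. ?g (Suc (card L)))"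
    using assms by (subst sum.Sigma) auto
  also have "\<dots> = (\<Sum>i = Suc 1..card K. real i * real (card K choose i) * ?g i)"
    by (rule star_sum[OF assms])
  finally show ?thesis by (simp add: numeral_2_eq_2)
qed

text \<open>At least two leaves means at least three points, so i starts at 3; the term i = 2 is
  contributed by the up-stars alone.\<close>

lemma sum_down_stars:
  assumes "finite K"
  shows "(\<Sum>E\<in>down_stars K. real (card (closed_subsets K E)) ^ m)
    = (\<Sum>i = 3..card K. real i * real (card K choose i) * (2 ^ (card K - 1) + 2 ^ (card K - i)) ^ m)"
proof -
  let ?I = "SIGMA c:K. {L. L \<subseteq> K - {c} \<and> 2 \<le> card L}"
  let ?g = "\<lambda>i. (2 ^ (card K - 1) + 2 ^ (card K - i) :: real) ^ m"
  have inj: "inj_on (\<lambda>(c, L). L \<times> {c}) ?I"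
    by (rule inj_onI) (auto simp: times_eq_iff)
  have "(\<Sum>E\<in>down_stars K. real (card (closed_subsets K E)) ^ m)
      = (\<Sum>(c, L)\<in>?I. real (card (closed_subsets K (L \<times> {c}))) ^ m)"
    unfolding down_stars_def by (subst sum.reindex[OF inj]) (simp add: case_prod_unfold)
  also have "\<dots> = (\<Sum>(c, L)\<in>?I. ?g (Suc (card L)))"
    using assms by (intro sum.cong) (auto simp: card_closed_subsets_down_star)
  also have "\<dots> = (\<Sum>c\<in>K. \<Sum>L | L \<subseteq> K - {c} \<and> 2 \<le> card L. ?g (Suc (card L)))"
    using assms by (subst sum.Sigma) auto
  also have "\<dots> = (\<Sum>i = Suc 2..card K. real i * real (card K choose i) * ?g i)"
    by (rule star_sum[OF assms])
  finally show ?thesis by simp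
qed

text \<open>A double edge comes from exactly two lists of four distinct points, which differ by
  swapping the edges, and there are 24 * C(k, 4) such lists, with k = \<open>card K\<close>.\<close>

lemma card_double_edges:
  assumes "finite K"
  shows "card (double_edges K) = 12 * (card K choose 4)"
proof -
  let ?T = "{xs. length xs = 4 \<and> distinct xs \<and> set xs \<subseteq> K}"
  define F where "F xs = {(xs ! 0, xs ! 1), (xs ! 2, xs ! (3::nat))}" for xs :: "'a list"
  have T_eq: "?T = {[a, b, c, d] | a b c d. distinct [a, b, c, d] \<and> {a, b, c, d} \<subseteq> K}"
    by (auto simp: eval_nat_numeral length_Suc_conv)
  have F_simp: "F [a, b, c, d] = {(a, b), (c, d)}" for a b c d
    by (simp add: F_def eval_nat_numeral)
  have img: "F ` ?T = double_edges K"
    proof (intro equalityI subsetI)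
    fix X assume "X \<in> F ` ?T"
    then obtain a b c d where "X = F [a, b, c, d]" "distinct [a, b, c, d]" "{a, b, c, d} \<subseteq> K"
      unfolding T_eq by blast
    then show "X \<in> double_edges K" unfolding double_edges_def F_simp by blast
  next
    fix X assume "X \<in> double_edges K"
    then obtain a b c d where "X = {(a, b), (c, d)}" "distinct [a, b, c, d]" "{a, b, c, d} \<subseteq> K"
      unfolding double_edges_def by blast
    then have "X = F [a, b, c, d]" "[a, b, c, d] \<in> ?T" by (simp_all add: F_simp)
    then show "X \<in> F ` ?T" by (rule image_eqI)
  qed
  have finT: "finite ?T"
    using finite_lists_length_eq[OF assms, of 4] by (rule rev_finite_subset) auto
  have fiber: "card {xs. xs \<in> ?T \<and> F xs = X} = 2" if X: "X \<in> double_edges K" for X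
  proof -
    obtain a b c d where X: "X = {(a, b), (c, d)}" and D: "distinct [a, b, c, d]" "{a, b, c, d} \<subseteq> K"
      using X unfolding double_edges_def by blast
    have "{xs. xs \<in> ?T \<and> F xs = X} = {[a, b, c, d], [c, d, a, b]}"
    proof (intro equalityI subsetI)
      fix xs assume "xs \<in> {xs. xs \<in> ?T \<and> F xs = X}"
      then obtain p q r s where "xs = [p, q, r, s]" "F xs = X" unfolding T_eq by blast
      then show "xs \<in> {[a, b, c, d], [c, d, a, b]}"
        using D by (auto simp: F_simp X doubleton_eq_iff)
    next
      fix xs assume "xs \<in> {[a, b, c, d], [c, d, a, b]}"
      then show "xs \<in> {xs. xs \<in> ?T \<and> F xs = X}" using D by (auto simp: F_simp X)
    qed
    then show ?thesis using D by simp
  qed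
  have "card ?T = (\<Sum>X\<in>F ` ?T. card {xs. xs \<in> ?T \<and> F xs = X})"
    using sum.image_gen[OF finT, of "\<lambda>_. 1::nat" F] by simp
  also have "\<dots> = 2 * card (double_edges K)" unfolding img using fiber by simp
  finally have T2: "card ?T = 2 * card (double_edges K)" .
  show ?thesis
  proof (cases "4 \<le> card K")
    case True
    have "card ?T = fact (card K) div fact (card K - 4)"
      using card_lists_distinct_length_eq[OF assms True] fact_div_fact[of "card K - 4" "card K"] by simp
    also have "fact (card K) = fact (card K - 4) * (24 * (card K choose 4))"
      using binomial_fact_lemma[OF True] by (simp add: fact_numeral mult_ac)
    also have "\<dots> div fact (card K - 4) = 24 * (card K choose 4)" by simp
    finally show ?thesis using T2 by simp
  next
    case False
    have "?T = {}"
    proof (rule ccontr)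
      assume "?T \<noteq> {}"
      then obtain xs where "length xs = 4" "distinct xs" "set xs \<subseteq> K" by blast
      then show False using False card_mono[OF assms, of "set xs"] by (simp add: distinct_card)
    qed
    then have "card ?T = 0" by (simp only: card.empty)
    then have "card (double_edges K) = 0" using T2 by linarith
    then show ?thesis using False by simp
  qed
qed

lemma sum_double_edges:
  assumes "finite K"
  shows "(\<Sum>E\<in>double_edges K. real (card (closed_subsets K E)) ^ m)
    = 12 * real (card K choose 4) * (2 ^ (card K - 1) + 2 ^ (card K - 4)) ^ m"
proof -
  have "(\<Sum>E\<in>double_edges K. real (card (closed_subsets K E)) ^ m)
      = (\<Sum>E\<in>double_edges K. (2 ^ (card K - 1) + 2 ^ (card K - 4)) ^ m)"
    by (intro sum.cong[OF refl])
       (use card_closed_subsets_double_edge[OF assms] in \<open>auto simp: double_edges_def\<close>)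
  then show ?thesis by (simp add: card_double_edges[OF assms])
qed

section \<open>The sum of up-set powers over all orders\<close>

text \<open>All edges of an up-star share their source and all edges of a down-star their target. A
  down-star has two different sources by its lower bound on the leaves, and a double edge differs in
  both coordinates.\<close>

lemma star_families_disjoint:
  "up_stars K \<inter> down_stars K = {}" "(up_stars K \<union> down_stars K) \<inter> double_edges K = {}"
  "{} \<notin> up_stars K \<union> down_stars K \<union> double_edges K"
proof -
  have up: "fst p = fst p'" if "E \<in> up_stars K" "p \<in> E" "p' \<in> E" for E p p'
    using that by (auto simp: up_stars_def)
  have down: "snd p = snd p'" if "E \<in> down_stars K" "p \<in> E" "p' \<in> E" for E p p'
    using that by (auto simp: down_stars_def)
  show "up_stars K \<inter> down_stars K = {}"
  proof (rule ccontr)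
    assume "up_stars K \<inter> down_stars K \<noteq> {}"
    then obtain E where E: "E \<in> up_stars K" "E \<in> down_stars K" by blast
    obtain c L where cL: "E = L \<times> {c}" "2 \<le> card L" using E(2) by (auto simp: down_stars_def)
    then obtain x y where "x \<in> L" "y \<in> L" "x \<noteq> y"
      by (metis card_le_Suc0_iff_eq card.infinite not_less_eq_eq numeral_2_eq_2 zero_le)
    then show False using up[OF E(1), of "(x, c)" "(y, c)"] cL by auto
  qed
  show "(up_stars K \<union> down_stars K) \<inter> double_edges K = {}"
  proof (rule ccontr)
    assume "(up_stars K \<union> down_stars K) \<inter> double_edges K \<noteq> {}"
    then obtain E where E: "E \<in> up_stars K \<or> E \<in> down_stars K" "E \<in> double_edges K" by blast
    obtain a b c d where D: "E = {(a, b), (c, d)}" "distinct [a, b, c, d]"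
      using E(2) unfolding double_edges_def by blast
    then show False using E(1) up[of E "(a, b)" "(c, d)"] down[of E "(a, b)" "(c, d)"] by auto
  qed
  show "{} \<notin> up_stars K \<union> down_stars K \<union> double_edges K"
  proof -
    have "E \<noteq> {}" if "E \<in> up_stars K \<union> down_stars K \<union> double_edges K" for E
      using that by (auto simp: up_stars_def down_stars_def double_edges_def
          dest!: Times_empty[THEN iffD1, OF sym])
    then show ?thesis by blast
  qed
qed

text \<open>When no two pairs of \<open>E\<close> compose, transitivity and antisymmetry only
  involve the diagonal. This makes every star and double edge the strict part of an order.\<close>

lemma partial_order_on_Id_on_Un:
  assumes "E \<subseteq> K \<times> K" "\<And>x y z. (x, y) \<in> E \<Longrightarrow> (y, z) \<notin> E"
  shows "partial_order_on K (Id_on K \<union> E)"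
  using assms unfolding partial_order_on_def preorder_on_def refl_on_def trans_def antisym_def
  by blast

lemma bipartite_families:
  assumes "E \<in> {{}} \<union> up_stars K \<union> down_stars K \<union> double_edges K"
  shows "E \<subseteq> K \<times> K" and "(x, y) \<in> E \<Longrightarrow> (y, z) \<notin> E"
  using assms by (auto simp: up_stars_def down_stars_def double_edges_def)

lemma partial_order_on_minus_Id:
  assumes "partial_order_on K q"
  shows "Id_on K \<union> (q - Id) = q"
  using assms by (auto simp: partial_order_on_def preorder_on_def refl_on_def)

lemma partial_orders_on_subset_Pow: "{q. partial_order_on K q} \<subseteq> Pow (K \<times> K)"
  by (auto simp: partial_order_on_def preorder_on_def)

lemma finite_partial_orders_on: "finite K \<Longrightarrow> finite {q. partial_order_on K q}"
  by (rule finite_subset[OF partial_orders_on_subset_Pow]) simp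

text \<open>This bound only enters the constant of the error term, so counting all relations is
  enough.\<close>

lemma card_partial_orders_on_le: "finite K \<Longrightarrow> card {q. partial_order_on K q} \<le> 2 ^ (card K * card K)"
  using card_mono[OF _ partial_orders_on_subset_Pow, of K] by (simp add: card_Pow card_cartesian_product)

text \<open>The orders whose strict part is empty, a star or a double edge give the main term
  exactly; each other order has at most \<open>2 ^ k / 2\<close> up-sets. Real division keeps this
  bound correct at k = 0, where \<open>2 ^ (k - 1)\<close> would be 1.\<close>

lemma sum_closed_subsets_power:
  fixes K :: "'a set"
  assumes fin: "finite K" and k: "k = card K"
  shows "\<bar>(\<Sum>q | partial_order_on K q. real (card (closed_subsets K q)) ^ m)
      - (2 ^ (k * m) + (\<Sum>i = 2..k. real (z_coeff i) * real (k choose i) * (2 ^ (k - 1) + 2 ^ (k - i)) ^ m))\<bar>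
    \<le> 2 ^ (k * k) * (2 ^ k / 2) ^ m"
proof -
  let ?P = "{q. partial_order_on K q}"
  let ?F = "{{}} \<union> up_stars K \<union> down_stars K \<union> double_edges K"
  let ?B = "(\<lambda>E. Id_on K \<union> E) ` ?F"
  let ?u = "\<lambda>q. real (card (closed_subsets K q)) ^ m"
  let ?g = "\<lambda>i. (2 ^ (k - 1) + 2 ^ (k - i) :: real) ^ m"
  have finP: "finite ?P" by (rule finite_partial_orders_on[OF fin])
  have cardP: "card ?P \<le> 2 ^ (k * k)" unfolding k by (rule card_partial_orders_on_le[OF fin])
  have BP: "?B \<subseteq> ?P"
  proof (intro image_subsetI CollectI)
    fix E assume "E \<in> ?F"
    then show "partial_order_on K (Id_on K \<union> E)"
      by (intro partial_order_on_Id_on_Un bipartite_families)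
  qed
  have mem: "q \<in> ?B" if "partial_order_on K q" "2 ^ k < 2 * card (closed_subsets K q)" for q
    using many_closed_subsets_cases[OF fin that(1)] that(2) k
    by (intro image_eqI[of _ _ "q - Id"]) (auto simp: partial_order_on_minus_Id[OF that(1)])
  have diffE: "(Id_on K \<union> E) - Id = E" if "E \<in> ?F" for E
    using bipartite_families(2)[OF that] by auto
  have inj: "inj_on (\<lambda>E. Id_on K \<union> E) ?F"
    using diffE by (intro inj_on_inverseI[of _ "\<lambda>q. q - Id"])
  have "(\<Sum>q\<in>?B. ?u q) = (\<Sum>E\<in>?F. ?u E)"
    unfolding sum.reindex[OF inj]
    by (rule sum.cong[OF refl]) (metis closed_subsets_minus_Id diffE comp_apply)
  also have "\<dots> = ?u {} + (\<Sum>E\<in>up_stars K. ?u E) + (\<Sum>E\<in>down_stars K. ?u E) + (\<Sum>E\<in>double_edges K. ?u E)"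
    using star_families_disjoint[of K] finite_star_families[OF fin]
    by (subst sum.union_disjoint; (subst sum.union_disjoint)?; (subst sum.union_disjoint)?) auto
  also have "\<dots> = 2 ^ (k * m) + (\<Sum>i = 2..k. real i * real (k choose i) * ?g i)
      + (\<Sum>i = 3..k. real i * real (k choose i) * ?g i) + 12 * real (k choose 4) * ?g 4"
    using sum_up_stars[OF fin, of m] sum_down_stars[OF fin, of m] sum_double_edges[OF fin, of m]
    by (simp add: k card_closed_subsets_empty[OF fin] power_mult)
  \<comment> \<open>All contributions are brought to the range from 2 to k. Up-stars give i,
    down-stars i from 3 on, and double edges 12 at i = 4, which add up to 2, 6, 4 + 4 + 12 = 20 and
    then 2i.\<close>
  also have "(\<Sum>i = 3..k. real i * real (k choose i) * ?g i)
      = (\<Sum>i = 2..k. (if 3 \<le> i then real i else 0) * real (k choose i) * ?g i)"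
    by (rule sum.mono_neutral_cong_left) auto
  \<comment> \<open>For k < 4 both sides vanish, since the binomial coefficient is 0.\<close>
  also have "12 * real (k choose 4) * ?g 4 = (\<Sum>i = 2..k. (if i = 4 then 12 else 0) * real (k choose i) * ?g i)"
  proof -
    have "(\<Sum>i = 2..k. (if i = 4 then 12 else 0) * real (k choose i) * ?g i)
        = (\<Sum>i = 2..k. if i = 4 then 12 * real (k choose 4) * ?g 4 else 0)"
      by (rule sum.cong) auto
    then show ?thesis by (simp add: sum.delta)
  qed
  also have "2 ^ (k * m) + (\<Sum>i = 2..k. real i * real (k choose i) * ?g i)
      + (\<Sum>i = 2..k. (if 3 \<le> i then real i else 0) * real (k choose i) * ?g i)
      + (\<Sum>i = 2..k. (if i = 4 then 12 else 0) * real (k choose i) * ?g i)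
    = 2 ^ (k * m) + (\<Sum>i = 2..k. real (z_coeff i) * real (k choose i) * ?g i)"
    unfolding add.assoc sum.distrib[symmetric]
    by (intro arg_cong2[of _ _ _ _ "(+)"] refl sum.cong) (auto simp: z_coeff_def algebra_simps)
  finally have B: "(\<Sum>q\<in>?B. ?u q)
      = 2 ^ (k * m) + (\<Sum>i = 2..k. real (z_coeff i) * real (k choose i) * ?g i)" .
  have small: "?u q \<le> (2 ^ k / 2) ^ m" if "q \<in> ?P - ?B" for q
  proof -
    have "2 * card (closed_subsets K q) \<le> 2 ^ k" using mem[of q] that by force
    then have "real (2 * card (closed_subsets K q)) \<le> real (2 ^ k)" by (rule of_nat_mono)
    then show ?thesis by (intro power_mono) auto
  qed
  have "(\<Sum>q\<in>?P. ?u q) - (\<Sum>q\<in>?B. ?u q) = (\<Sum>q\<in>?P - ?B. ?u q)"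
    using sum_diff[OF finP BP, of ?u] by simp
  moreover have "(\<Sum>q\<in>?P - ?B. ?u q) \<le> real (card (?P - ?B)) * (2 ^ k / 2) ^ m"
    using small by (rule sum_bounded_above)
  moreover have "real (card (?P - ?B)) \<le> 2 ^ (k * k)"
  proof -
    have "card (?P - ?B) \<le> 2 ^ (k * k)" using cardP card_mono[OF finP, of "?P - ?B"] by auto
    then have "real (card (?P - ?B)) \<le> real (2 ^ (k * k))" by (rule of_nat_mono)
    then show ?thesis by simp
  qed
  then have "real (card (?P - ?B)) * (2 ^ k / 2) ^ m \<le> 2 ^ (k * k) * (2 ^ k / 2) ^ m"
    by (rule mult_right_mono) simp
  moreover have "0 \<le> (\<Sum>q\<in>?P - ?B. ?u q)" by (simp add: sum_nonneg)
  ultimately show ?thesis unfolding B[symmetric] by linarith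
qed

section \<open>Orders as covering tuples of up-sets\<close>

text \<open>Among the elements below \<open>y\<close>, one with the fewest predecessors is minimal:
  anything strictly below it would have strictly fewer.\<close>

lemma ex_minimal_below:
  assumes "finite A" "partial_order_on A r" "y \<in> A"
  shows "\<exists>x \<in> minimal_elements A r. (x, y) \<in> r"
proof -
  have rA: "r \<subseteq> A \<times> A" and rfl: "\<And>x. x \<in> A \<Longrightarrow> (x, x) \<in> r" and tr: "trans r" and an: "antisym r"
    using assms(2) by (auto simp: partial_order_on_def preorder_on_def refl_on_def)
  let ?d = "\<lambda>x. card {z. (z, x) \<in> r}"
  have fin: "finite {z. (z, x) \<in> r}" for x
    using assms(1) by (rule rev_finite_subset) (use rA in auto)
  obtain x where x: "(x, y) \<in> r" "\<And>z. (z, y) \<in> r \<Longrightarrow> ?d x \<le> ?d z"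
    using ex_has_least_nat[of "\<lambda>x. (x, y) \<in> r" y ?d] rfl[OF assms(3)] by blast
  have "z = x" if z: "(z, x) \<in> r" for z
  proof (rule ccontr)
    assume "z \<noteq> x"
    then have "(x, z) \<notin> r" using z an by (auto dest: antisymD)
    moreover have "(x, x) \<in> r" using x(1) rA rfl by auto
    ultimately have "{w. (w, z) \<in> r} \<subset> {w. (w, x) \<in> r}" using z tr by (auto dest: transD)
    then have "?d z < ?d x" by (rule psubset_card_mono[OF fin])
    moreover have "?d x \<le> ?d z" using x z tr by (blast dest: transD)
    ultimately show False by simp
  qed
  then have "x \<in> minimal_elements A r" using x(1) rA by (auto simp: minimal_elements_def)
  then show ?thesis using x(1) by blast
qed

text \<open>Tuples are extensional functions, so values outside \<open>M\<close> are fixed and the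
  set of tuples is finite for finite \<open>M\<close> and \<open>K\<close>.\<close>

definition upset_covers :: "'a set \<Rightarrow> 'a set \<Rightarrow> 'a rel \<Rightarrow> ('a \<Rightarrow> 'a set) set" where
  "upset_covers M K q = {f \<in> M \<rightarrow>\<^sub>E closed_subsets K q. (\<Union>x\<in>M. f x) = K}"

text \<open>
  An order is determined by its restriction to the non-minimal elements and by the up-set of
  non-minimal elements above each minimal one; these up-sets must cover, since every element lies
  above a minimal one.
\<close>

lemma bij_betw_orders_upset_covers:
  assumes "finite M" "finite K" and disj: "M \<inter> K = {}"
  shows "bij_betw (\<lambda>r. (r \<inter> K \<times> K, \<lambda>x\<in>M. {y \<in> K. (x, y) \<in> r}))
    {r. partial_order_on (M \<union> K) r \<and> minimal_elements (M \<union> K) r = M}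
    (SIGMA q:{q. partial_order_on K q}. upset_covers M K q)"
    (is "bij_betw ?Phi ?A ?B")
proof (rule bij_betw_byWitness[where f' = "\<lambda>(q, f). Id_on M \<union> q \<union> Sigma M f"])
  have A: "r \<subseteq> (M \<union> K) \<times> (M \<union> K)" "\<And>x. x \<in> M \<union> K \<Longrightarrow> (x, x) \<in> r"
      "trans r" "antisym r" "\<And>x y. (y, x) \<in> r \<Longrightarrow> x \<in> M \<Longrightarrow> y = x"
      "\<And>y. y \<in> K \<Longrightarrow> \<exists>x\<in>M. (x, y) \<in> r" if "r \<in> ?A" for r
  proof -
    show "r \<subseteq> (M \<union> K) \<times> (M \<union> K)" "\<And>x. x \<in> M \<union> K \<Longrightarrow> (x, x) \<in> r" "trans r" "antisym r"
      using that by (auto simp: partial_order_on_def preorder_on_def refl_on_def)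
    then show "y = x" if "(y, x) \<in> r" "x \<in> M" for x y
      using that \<open>r \<in> ?A\<close> unfolding minimal_elements_def by blast
    show "\<exists>x\<in>M. (x, y) \<in> r" if "y \<in> K" for y
      using ex_minimal_below[of "M \<union> K" r y] assms that \<open>r \<in> ?A\<close> by auto
  qed
  have B: "q \<subseteq> K \<times> K" "\<And>x. x \<in> K \<Longrightarrow> (x, x) \<in> q" "trans q" "antisym q"
      "\<And>x. x \<in> M \<Longrightarrow> f x \<subseteq> K" "\<And>x y z. x \<in> M \<Longrightarrow> y \<in> f x \<Longrightarrow> (y, z) \<in> q \<Longrightarrow> z \<in> f x"
      "\<And>y. y \<in> K \<Longrightarrow> \<exists>x\<in>M. y \<in> f x" "f \<in> extensional M" if "(q, f) \<in> ?B" for q f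
  proof -
    show q: "q \<subseteq> K \<times> K" "\<And>x. x \<in> K \<Longrightarrow> (x, x) \<in> q" "trans q" "antisym q"
      using that by (auto simp: partial_order_on_def preorder_on_def refl_on_def)
    have f: "f \<in> M \<rightarrow>\<^sub>E closed_subsets K q" "(\<Union>x\<in>M. f x) = K"
      using that by (auto simp: upset_covers_def)
    show "f \<in> extensional M" using f(1) by (simp add: PiE_def)
    show "\<exists>x\<in>M. y \<in> f x" if "y \<in> K" for y using f(2) that by blast
    have mem: "f x \<in> closed_subsets K q" if "x \<in> M" for x using f(1) that by (rule PiE_mem)
    show "f x \<subseteq> K" if "x \<in> M" for x using mem[OF that] by (simp add: closed_subsets_def)
    show "z \<in> f x" if "x \<in> M" "y \<in> f x" "(y, z) \<in> q" for x y z
      using mem[OF that(1)] that(2,3) q(1) unfolding closed_subsets_def by blast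
  qed
  show "\<forall>r\<in>?A. (case ?Phi r of (q, f) \<Rightarrow> Id_on M \<union> q \<union> Sigma M f) = r"
  proof
    fix r assume r: "r \<in> ?A"
    \<comment> \<open>Only diagonal pairs end in \<open>M\<close>, by minimality, so the three
      pieces exhaust \<open>r\<close>.\<close>
    have "Id_on M \<union> r \<inter> K \<times> K \<union> Sigma M (\<lambda>x\<in>M. {y \<in> K. (x, y) \<in> r}) = r"
    proof (rule set_eqI, clarify)
      fix x y
      show "(x, y) \<in> Id_on M \<union> r \<inter> K \<times> K \<union> Sigma M (\<lambda>x\<in>M. {y \<in> K. (x, y) \<in> r}) \<longleftrightarrow> (x, y) \<in> r"
        using A(1)[OF r] A(2)[OF r, of x] A(5)[OF r, of x y] by auto
    qed
    then show "(case ?Phi r of (q, f) \<Rightarrow> Id_on M \<union> q \<union> Sigma M f) = r" by simp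
  qed
  show "\<forall>p\<in>?B. ?Phi (case p of (q, f) \<Rightarrow> Id_on M \<union> q \<union> Sigma M f) = p"
  proof
    fix p assume "p \<in> ?B"
    moreover obtain q f where p: "p = (q, f)" by (cases p)
    ultimately have qf: "(q, f) \<in> ?B" by simp
    have "(Id_on M \<union> q \<union> Sigma M f) \<inter> K \<times> K = q" using B(1)[OF qf] disj by blast
    moreover have "(\<lambda>x\<in>M. {y \<in> K. (x, y) \<in> Id_on M \<union> q \<union> Sigma M f}) = f"
    proof (rule extensionalityI[OF restrict_extensional B(8)[OF qf]])
      fix x assume x: "x \<in> M"
      show "(\<lambda>x\<in>M. {y \<in> K. (x, y) \<in> Id_on M \<union> q \<union> Sigma M f}) x = f x"
        using x B(1)[OF qf] B(5)[OF qf x] disj by auto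
    qed
    ultimately show "?Phi (case p of (q, f) \<Rightarrow> Id_on M \<union> q \<union> Sigma M f) = p" by (simp add: p)
  qed
  show "?Phi ` ?A \<subseteq> ?B"
  proof (rule image_subsetI)
    fix r assume r: "r \<in> ?A"
    have "partial_order_on K (r \<inter> K \<times> K)"
      using A(2)[OF r] A(3)[OF r] A(4)[OF r]
      unfolding partial_order_on_def preorder_on_def refl_on_def trans_def antisym_def by blast
    moreover have "(\<lambda>x\<in>M. {y \<in> K. (x, y) \<in> r}) \<in> M \<rightarrow>\<^sub>E closed_subsets K (r \<inter> K \<times> K)"
      using A(3)[OF r] by (auto simp: closed_subsets_def dest: transD)
    moreover have "(\<Union>x\<in>M. (\<lambda>x\<in>M. {y \<in> K. (x, y) \<in> r}) x) = K"
      using A(6)[OF r] by auto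
    ultimately show "?Phi r \<in> ?B" by (simp add: upset_covers_def)
  qed
  show "(\<lambda>(q, f). Id_on M \<union> q \<union> Sigma M f) ` ?B \<subseteq> ?A"
  proof (rule image_subsetI)
    fix p assume "p \<in> ?B"
    moreover obtain q f where p: "p = (q, f)" by (cases p)
    ultimately have qf: "(q, f) \<in> ?B" by simp
    let ?r = "Id_on M \<union> q \<union> Sigma M f"
    note b = B[OF qf]
    have sub: "?r \<subseteq> (M \<union> K) \<times> (M \<union> K)" using b(1,5) by blast
    have "trans ?r"
    proof (rule transI)
      fix x y z assume xy: "(x, y) \<in> ?r" and yz: "(y, z) \<in> ?r"
      \<comment> \<open>A middle point in \<open>K\<close> forces the second pair into
        \<open>q\<close>; then transitivity of \<open>q\<close> or closedness of \<open>f x\<close>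
        applies.\<close>
      consider "x = y" | "(x, y) \<in> q" | "x \<in> M" "y \<in> f x" using xy by blast
      then show "(x, z) \<in> ?r"
      proof cases
        case 1
        then show ?thesis using yz by simp
      next
        case 2
        then have "y \<notin> M" using b(1) disj by blast
        then have "(y, z) \<in> q" using yz by blast
        then show ?thesis using 2 b(3) by (blast dest: transD)
      next
        case 3
        then have "y \<notin> M" using b(5) disj by blast
        then have "(y, z) \<in> q" using yz by blast
        then show ?thesis using 3 b(6) by blast
      qed
    qed
    moreover have "antisym ?r"
    proof (rule antisymI)
      fix x y assume xy: "(x, y) \<in> ?r" and yx: "(y, x) \<in> ?r"
      show "x = y"
      proof (cases "x \<in> M")
        case True
        then have "(y, x) \<notin> q" "\<And>w. w \<in> M \<Longrightarrow> x \<notin> f w" using b(1,5) disj by blast+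
        then show ?thesis using yx by blast
      next
        case False
        then have xyq: "(x, y) \<in> q" using xy by blast
        then have "y \<notin> M" using b(1) disj by blast
        then have "(y, x) \<in> q" using yx by blast
        then show ?thesis using xyq b(4) by (blast dest: antisymD)
      qed
    qed
    moreover have "\<forall>x\<in>M \<union> K. (x, x) \<in> ?r" using b(2) by blast
    ultimately have "partial_order_on (M \<union> K) ?r"
      unfolding partial_order_on_def preorder_on_def refl_on_def using sub by blast
    moreover have "minimal_elements (M \<union> K) ?r = M"
    proof (intro equalityI subsetI)
      fix x assume x: "x \<in> minimal_elements (M \<union> K) ?r"
      show "x \<in> M"
      proof (rule ccontr)
        assume "x \<notin> M"
        then have "x \<in> K" using x by (auto simp: minimal_elements_def)
        \<comment> \<open>The covering condition is what keeps points of \<open>K\<close> from being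
          minimal.\<close>
        then obtain w where "w \<in> M" "x \<in> f w" using b(7) by blast
        then have "w = x" using x unfolding minimal_elements_def by blast
        then show False using \<open>w \<in> M\<close> \<open>x \<notin> M\<close> by simp
      qed
    next
      fix x assume x: "x \<in> M"
      then have "y = x" if "(y, x) \<in> ?r" for y using that b(1,5) disj by blast
      then show "x \<in> minimal_elements (M \<union> K) ?r" using x unfolding minimal_elements_def by blast
    qed
    ultimately have "?r \<in> ?A" by blast
    then show "(case p of (q, f) \<Rightarrow> Id_on M \<union> q \<union> Sigma M f) \<in> ?A" by (simp add: p)
  qed
qed

section \<open>Counting covering tuples\<close>

lemma finite_upset_covers: "finite M \<Longrightarrow> finite K \<Longrightarrow> finite (upset_covers M K q)"
  unfolding upset_covers_def
  by (rule finite_subset[of _ "M \<rightarrow>\<^sub>E closed_subsets K q"]) (auto intro: finite_PiE finite_closed_subsets)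

lemma num_orders_eq_sum:
  "num_orders k m = (\<Sum>q | partial_order_on {m + 1..m + k} q. card (upset_covers {1..m} {m + 1..m + k} q))"
proof -
  have "{1..m + k} = {1..m} \<union> {m + 1..m + k}" by auto
  then show ?thesis
    unfolding num_orders_def
    using bij_betw_same_card[OF bij_betw_orders_upset_covers[of "{1..m}" "{m + 1..m + k}"]]
    by (simp add: finite_upset_covers finite_partial_orders_on)
qed

lemma card_upset_covers_le:
  assumes "finite M" "finite K"
  shows "card (upset_covers M K q) \<le> card (closed_subsets K q) ^ card M"
proof -
  have "card (upset_covers M K q) \<le> card (M \<rightarrow>\<^sub>E closed_subsets K q)"
    using assms unfolding upset_covers_def
    by (intro card_mono) (auto intro: finite_PiE finite_closed_subsets)
  then show ?thesis using assms by (simp add: card_PiE)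
qed

text \<open>A tuple that fails to cover misses some y in \<open>K\<close>, hence consists of subsets
  of \<open>K - {y}\<close>; a union bound over y gives the error.\<close>

lemma card_upset_covers_ge:
  assumes "finite M" "finite K"
  shows "card (closed_subsets K q) ^ card M
    \<le> card (upset_covers M K q) + card K * (2 ^ (card K - 1)) ^ card M"
proof -
  let ?N = "\<lambda>y. M \<rightarrow>\<^sub>E Pow (K - {y})"
  have fin: "finite (?N y)" for y using assms by (auto intro: finite_PiE)
  have sub: "M \<rightarrow>\<^sub>E closed_subsets K q \<subseteq> upset_covers M K q \<union> (\<Union>y\<in>K. ?N y)"
  proof
    fix f assume f: "f \<in> M \<rightarrow>\<^sub>E closed_subsets K q"
    then have fK: "f x \<subseteq> K" if "x \<in> M" for x
      using closed_subsets_subset_Pow PiE_mem[OF f that] by blast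
    show "f \<in> upset_covers M K q \<union> (\<Union>y\<in>K. ?N y)"
    proof (cases "(\<Union>x\<in>M. f x) = K")
      case False
      then obtain y where y: "y \<in> K" "\<And>x. x \<in> M \<Longrightarrow> y \<notin> f x" using fK by blast
      have "f \<in> ?N y" using f fK y(2) by (intro PiE_I) (auto dest: PiE_arb)
      then show ?thesis using y(1) by blast
    qed (use f in \<open>simp add: upset_covers_def\<close>)
  qed
  have "card (closed_subsets K q) ^ card M = card (M \<rightarrow>\<^sub>E closed_subsets K q)"
    using assms by (simp add: card_PiE)
  also have "\<dots> \<le> card (upset_covers M K q \<union> (\<Union>y\<in>K. ?N y))"
    using sub assms fin by (intro card_mono) (auto simp: finite_upset_covers)
  also have "\<dots> \<le> card (upset_covers M K q) + card (\<Union>y\<in>K. ?N y)" by (rule card_Un_le)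
  also have "card (\<Union>y\<in>K. ?N y) \<le> (\<Sum>y\<in>K. card (?N y))" by (rule card_UN_le[OF assms(2)])
  also have "\<dots> = card K * (2 ^ (card K - 1)) ^ card M"
    using assms by (simp add: card_PiE card_Pow)
  finally show ?thesis by simp
qed

text \<open>Non-covering tuples cost at most k times \<open>(2 ^ k / 2) ^ m\<close> for each of at
  most \<open>2 ^ (k * k)\<close> orders; the orders with few up-sets cost one more such term,
  whence the factor k + 1.\<close>

lemma num_orders_approx:
  "\<bar>real (num_orders k m)
      - (2 ^ (k * m) + (\<Sum>i = 2..k. real (z_coeff i) * real (k choose i) * (2 ^ (k - 1) + 2 ^ (k - i)) ^ m))\<bar>
    \<le> (real k + 1) * 2 ^ (k * k) * (2 ^ k / 2) ^ m"
proof -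
  define M where "M = {1..m}"
  define K where "K = {m + 1..m + k}"
  have fin: "finite M" "finite K" and card: "card M = m" "card K = k" by (auto simp: M_def K_def)
  let ?P = "{q. partial_order_on K q}"
  let ?h = "(2 ^ k / 2) ^ m :: real"
  have cP: "card ?P \<le> 2 ^ (k * k)" using card_partial_orders_on_le[OF fin(2)] card by simp
  have pt: "\<bar>real (card (upset_covers M K q)) - real (card (closed_subsets K q)) ^ m\<bar> \<le> real k * ?h" for q
  proof -
    have "real (card (upset_covers M K q)) \<le> real (card (closed_subsets K q) ^ m)"
      using card_upset_covers_le[OF fin, of q] card by (intro of_nat_mono) simp
    moreover have "real (card (closed_subsets K q) ^ m)
        \<le> real (card (upset_covers M K q) + k * (2 ^ (k - 1)) ^ m)"
      using card_upset_covers_ge[OF fin, of q] card by (intro of_nat_mono) simp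
    \<comment> \<open>The truncated exponent \<open>k - 1\<close> differs from halving only at k =
      0, where the factor k vanishes.\<close>
    moreover have "real k * (2 ^ (k - 1)) ^ m = real k * ?h" by (cases k) auto
    ultimately show ?thesis unfolding of_nat_add of_nat_mult of_nat_power of_nat_numeral by linarith
  qed
  have "\<bar>real (num_orders k m) - (\<Sum>q\<in>?P. real (card (closed_subsets K q)) ^ m)\<bar>
      = \<bar>\<Sum>q\<in>?P. real (card (upset_covers M K q)) - real (card (closed_subsets K q)) ^ m\<bar>"
    by (simp add: num_orders_eq_sum M_def K_def sum_subtractf)
  also have "\<dots> \<le> (\<Sum>q\<in>?P. real k * ?h)"
    by (rule order_trans[OF sum_abs sum_mono[OF pt]])
  also have "\<dots> = real (card ?P) * (real k * ?h)" by simp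
  also have "\<dots> \<le> real (2 ^ (k * k)) * (real k * ?h)"
    by (intro mult_right_mono of_nat_mono cP) simp
  finally have 1: "\<bar>real (num_orders k m) - (\<Sum>q\<in>?P. real (card (closed_subsets K q)) ^ m)\<bar>
      \<le> 2 ^ (k * k) * (real k * ?h)" by simp
  have 2: "(real k + 1) * 2 ^ (k * k) * ?h = 2 ^ (k * k) * (real k * ?h) + 2 ^ (k * k) * ?h"
    by (simp only: algebra_simps)
  show ?thesis unfolding 2
    using 1 sum_closed_subsets_power[OF fin(2), of k m] card by linarith
qed

section \<open>The asymptotic expansion\<close>

theorem theorem6p5:
  fixes k :: nat
  shows "(\<exists>err :: nat \<Rightarrow> real. err \<in> O(\<lambda>m. 2 powr ((real k - 1) * real m)) \<and>
           (\<forall>m\<ge>1. real (num_orders k m) =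
              2 ^ (k * m)
              + (\<Sum>i = 2..k. real (z_coeff i) * real (k choose i) * (2 ^ (k - 1) + 2 ^ (k - i)) ^ m)
              + err m))
       \<and> (\<exists>err :: nat \<Rightarrow> real. err \<in> O(\<lambda>m. (3 / 4) ^ m) \<and>
           (\<forall>m\<ge>1. real (num_orders k m) = 2 ^ (k * m) * (1 + err m)))
       \<and> (\<lambda>m. real (num_orders k m)) \<sim>[at_top] (\<lambda>m. 2 ^ (k * m))"
proof -
  define S where "S m = (\<Sum>i = 2..k. real (z_coeff i) * real (k choose i) * (2 ^ (k - 1) + 2 ^ (k - i)) ^ m)" for m
  define err1 where "err1 m = real (num_orders k m) - 2 ^ (k * m) - S m" for m
  define err2 where "err2 m = real (num_orders k m) / 2 ^ (k * m) - 1" for m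
  let ?C = "(real k + 1) * 2 ^ (k * k)"
  let ?D = "\<Sum>i = 2..k. real (z_coeff i) * real (k choose i)"
  have b1: "\<bar>err1 m\<bar> \<le> ?C * (2 ^ k / 2) ^ m" for m
    using num_orders_approx[of k m] by (simp add: err1_def S_def diff_diff_eq)
  \<comment> \<open>The exponent is a real number, so at k = 0 it is -m, in agreement with the bound
    by halving.\<close>
  have half: "(2 ^ k / 2 :: real) ^ m = 2 powr ((real k - 1) * real m)" for m
    by (simp add: powr_powr[symmetric] powr_diff powr_realpow)
  have O1: "err1 \<in> O(\<lambda>m. 2 powr ((real k - 1) * real m))"
    using b1 by (intro bigoI[of _ ?C]) (simp add: half)
  have S0: "0 \<le> S m" for m unfolding S_def by (intro sum_nonneg) simp
  \<comment> \<open>The largest base occurs at i = 2, where 2^(k - 1) + 2^(k - 2) is three quarters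
    of 2^k.\<close>
  have S1: "S m \<le> ?D * (2 ^ k * (3 / 4)) ^ m" for m
    unfolding S_def sum_distrib_right
  proof (intro sum_mono mult_left_mono power_mono)
    fix i assume i: "i \<in> {2..k}"
    then have "(2::real) ^ (k - i) \<le> 2 ^ (k - 2)" by (intro power_increasing) auto
    moreover obtain n where "k = n + 2" using i le_Suc_ex[of 2 k] by (auto simp: add.commute)
    ultimately show "(2::real) ^ (k - 1) + 2 ^ (k - i) \<le> 2 ^ k * (3 / 4)"
      by (simp add: power_add)
  qed auto
  have b2: "\<bar>err2 m\<bar> \<le> (?C + ?D) * (3 / 4) ^ m" for m
  proof -
    have "\<bar>err2 m\<bar> = \<bar>err1 m + S m\<bar> / 2 ^ (k * m)"
      by (simp add: err2_def err1_def field_simps)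
    also have "\<bar>err1 m + S m\<bar> \<le> ?C * (2 ^ k * (3 / 4)) ^ m + ?D * (2 ^ k * (3 / 4)) ^ m"
    proof -
      \<comment> \<open>As 1/2 is below 3/4, the first error is absorbed into the bound for
        \<open>S\<close>.\<close>
      have "?C * (2 ^ k / 2) ^ m \<le> ?C * (2 ^ k * (3 / 4)) ^ m"
        by (intro mult_left_mono power_mono) auto
      then show ?thesis using b1[of m] S0[of m] S1[of m] by linarith
    qed
    also have "\<dots> = (?C + ?D) * (3 / 4) ^ m * 2 ^ (k * m)"
      unfolding power_mult_distrib power_mult[symmetric] by (simp only: algebra_simps)
    finally show ?thesis by (simp add: divide_right_mono)
  qed
  have O2: "err2 \<in> O(\<lambda>m. (3 / 4) ^ m)"
    using b2 by (intro bigoI[of _ "?C + ?D"]) simp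
  have eq2: "real (num_orders k m) = 2 ^ (k * m) * (1 + err2 m)" for m
    by (simp add: err2_def)
  have "err2 \<longlonglongrightarrow> 0"
  proof (rule tendsto_0_le)
    show "(\<lambda>m. (3 / 4) ^ m :: real) \<longlonglongrightarrow> 0" by (rule LIMSEQ_power_zero) simp
    show "\<forall>\<^sub>F m in sequentially. norm (err2 m) \<le> norm ((3 / 4) ^ m :: real) * (?C + ?D)"
      using b2 by (simp add: mult.commute)
  qed
  then have "(\<lambda>m. 1 + err2 m) \<longlonglongrightarrow> 1 + 0" by (intro tendsto_intros)
  then have "(\<lambda>m. real (num_orders k m)) \<sim>[at_top] (\<lambda>m. 2 ^ (k * m))"
    by (intro asymp_equivI') (simp add: err2_def)
  moreover have "\<forall>m\<ge>1. real (num_orders k m) = 2 ^ (k * m) + S m + err1 m" by (simp add: err1_def)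
  ultimately show ?thesis using O1 O2 eq2 unfolding S_def by blast
qed

end
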